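(* Let $P$ and $Q$ be finite naturally labeled posets with $K_P(\mathbf{x}) = K_Q(\mathbf{x})$. Then $\mathrm{anti}_{k,i,j}(P) = \mathrm{anti}_{k,i,j}(Q)$ for all triples $(k,i,j)$ of nonnegative integers.
   Context: A poset $(P,\preceq)$ on ground set $[n]=\{1,\dots,n\}$ is naturally labeled if $x\preceq y$ implies $x\le y$ as integers. For such $P$, the $P$-partition generating function is $K_P(\mathbf{x})=\sum_{\sigma}\prod_{p\in P}x_{\sigma(p)}$, the sum over all maps $\sigma:P\to\mathbb{Z}^+$ with $\sigma(x)\le\sigma(y)$ whenever $x\preceq y$. An order ideal of $P$ is a subset $I$ such that $x\in I$ and $y\preceq x$ imply $y\in I$. For a poset $P$, $\mathrm{anti}_{k,i,j}(P)$ denotes the number of order ideals $I$ of $P$ with $|I|=k$ such that $I$ has exactly $i$ maximal elements and $P\setminus I$ has exactly $j$ minimal elements. *)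

theory Defs
  imports "HOL-Library.FuncSet" "HOL-Library.Poly_Mapping"
begin

text \<open>
  A poset on \<open>[n]\<close> is given by \<open>n\<close> and its order relation \<open>r\<close>, where \<open>(x, y) \<in> r\<close> means
  \<open>x \<preceq> y\<close>; \<open>n = 0\<close> (the empty poset) is allowed.
\<close>

definition naturally_labeled_poset :: "nat \<Rightarrow> (nat \<times> nat) set \<Rightarrow> bool" where
  "naturally_labeled_poset n r \<longleftrightarrow>
     partial_order_on {1..n} r \<and> (\<forall>x y. (x, y) \<in> r \<longrightarrow> x \<le> y)"

text \<open>Using extensional functions, each map \<open>[n] \<rightarrow> \<int>\<^sup>+\<close> is represented exactly once.\<close>

definition P_partitions :: "nat \<Rightarrow> (nat \<times> nat) set \<Rightarrow> (nat \<Rightarrow> nat) set" where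
  "P_partitions n r =
     {\<sigma> \<in> {1..n} \<rightarrow>\<^sub>E {1..}. \<forall>x y. (x, y) \<in> r \<longrightarrow> \<sigma> x \<le> \<sigma> y}"

text \<open>
  A monomial in the variables \<open>x\<^sub>1, x\<^sub>2, \<dots>\<close> is represented by its finitely supported exponent
  vector, so a product of monomials becomes a sum of exponent vectors. A formal power series
  in these variables is an arbitrary function from monomials to coefficients.
\<close>

type_synonym monomial = "nat \<Rightarrow>\<^sub>0 nat"

type_synonym power_series = "monomial \<Rightarrow> int"

definition P_monomial :: "nat \<Rightarrow> (nat \<Rightarrow> nat) \<Rightarrow> monomial" where
  "P_monomial n \<sigma> = (\<Sum>p\<in>{1..n}. Poly_Mapping.single (\<sigma> p) 1)"

text \<open>
  The infinite formal sum of the monomials of all \<open>P\<close>-partitions: the coefficient of a monomial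
  \<open>m\<close> is the number of \<open>P\<close>-partitions with monomial \<open>m\<close>, which is finite by the
  lemma \<open>finite_P_partitions_with_monomial\<close> below.
\<close>

definition K :: "nat \<Rightarrow> (nat \<times> nat) set \<Rightarrow> power_series" where
  "K n r = (\<lambda>m. int (card {\<sigma> \<in> P_partitions n r. P_monomial n \<sigma> = m}))"

lemma lookup_P_monomial:
  "Poly_Mapping.lookup (P_monomial n \<sigma>) v = card {p \<in> {1..n}. \<sigma> p = v}"
proof -
  have "Poly_Mapping.lookup (P_monomial n \<sigma>) v = (\<Sum>p\<in>{1..n}. if \<sigma> p = v then 1 else 0)"
    by (simp add: P_monomial_def lookup_sum lookup_single when_def del: One_nat_def)
  also have "\<dots> = card {p \<in> {1..n}. \<sigma> p = v}"
    by (simp add: sum.If_cases Int_def del: One_nat_def)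
  finally show ?thesis .
qed

lemma finite_P_partitions_with_monomial:
  "finite {\<sigma> \<in> P_partitions n r. P_monomial n \<sigma> = m}"
proof (rule finite_subset)
  show "{\<sigma> \<in> P_partitions n r. P_monomial n \<sigma> = m}
      \<subseteq> {1..n} \<rightarrow>\<^sub>E Poly_Mapping.keys m"
  proof
    fix \<sigma> assume a: "\<sigma> \<in> {\<sigma> \<in> P_partitions n r. P_monomial n \<sigma> = m}"
    then have e: "\<sigma> \<in> {1..n} \<rightarrow>\<^sub>E {1..}" and m: "m = P_monomial n \<sigma>"
      by (auto simp: P_partitions_def)
    have "\<sigma> p \<in> Poly_Mapping.keys m" if "p \<in> {1..n}" for p
    proof -
      have "finite {q \<in> {1..n}. \<sigma> q = \<sigma> p}" "p \<in> {q \<in> {1..n}. \<sigma> q = \<sigma> p}"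
        using that by auto
      then have "card {q \<in> {1..n}. \<sigma> q = \<sigma> p} \<noteq> 0"
        by (metis card_0_eq empty_iff)
      then show ?thesis
        by (simp only: m in_keys_iff lookup_P_monomial) simp
    qed
    then show "\<sigma> \<in> {1..n} \<rightarrow>\<^sub>E Poly_Mapping.keys m"
      using e by (auto simp: PiE_iff)
  qed
qed (auto intro: finite_PiE)

definition order_ideal :: "nat \<Rightarrow> (nat \<times> nat) set \<Rightarrow> nat set \<Rightarrow> bool" where
  "order_ideal n r I \<longleftrightarrow> I \<subseteq> {1..n} \<and> (\<forall>x y. x \<in> I \<and> (y, x) \<in> r \<longrightarrow> y \<in> I)"

definition maximal_elements :: "('a \<times> 'a) set \<Rightarrow> 'a set \<Rightarrow> 'a set" where
  "maximal_elements r A = {x \<in> A. \<forall>y\<in>A. (x, y) \<in> r \<longrightarrow> y = x}"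

definition minimal_elements :: "('a \<times> 'a) set \<Rightarrow> 'a set \<Rightarrow> 'a set" where
  "minimal_elements r A = {x \<in> A. \<forall>y\<in>A. (y, x) \<in> r \<longrightarrow> y = x}"

definition anti :: "nat \<Rightarrow> nat \<Rightarrow> nat \<Rightarrow> nat \<Rightarrow> (nat \<times> nat) set \<Rightarrow> nat" where
  "anti k i j n r =
     card {I. order_ideal n r I \<and> card I = k
              \<and> card (maximal_elements r I) = i
              \<and> card (minimal_elements r ({1..n} - I)) = j}"

end

theory Submission
  imports Defs
begin

text \<open>
  The coefficient of \<open>x\<^sub>1\<^bsup>b\<^sub>1\<^esup> \<cdots> x\<^sub>l\<^bsup>b\<^sub>l\<^esup>\<close> in \<open>K\<^sub>P\<close> counts the chains of order
  ideals from \<open>\<emptyset>\<close> to \<open>P\<close> with steps of sizes \<open>b\<^sub>1, \<dots>, b\<^sub>l\<close>. Summing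
  \<open>(- 1)\<^sup>l\<close> over all refinements of one step computes the Moebius function of the lattice of
  ideals, which is \<open>(- 1)\<^bsup>\<bar>I - J\<bar>\<^esup>\<close> if \<open>I - J\<close> is an antichain and \<open>0\<close>
  otherwise. Hence \<open>K\<^sub>P\<close> determines the number of triples \<open>J \<subseteq> I \<subseteq> L\<close> of ideals with
  \<open>\<bar>I\<bar> = k\<close> where \<open>I - J\<close> and \<open>L - I\<close> are antichains of sizes \<open>a\<close> and \<open>b\<close>.
  Such a triple is an ideal \<open>I\<close> with \<open>a\<close> chosen maximal elements of \<open>I\<close> and \<open>b\<close> chosen
  minimal elements of \<open>P - I\<close>, so binomial inversion in \<open>a\<close> and \<open>b\<close> recovers the numbers
  \<open>anti\<^sub>k\<^sub>,\<^sub>i\<^sub>,\<^sub>j(P)\<close>.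
\<close>

section \<open>Alternating sums over compositions\<close>

text \<open>\<open>comp_sum a F\<close> is the sum of \<open>(- 1) ^ length \<beta> * F \<beta>\<close> over the compositions \<open>\<beta>\<close> of \<open>a\<close>.\<close>

function comp_sum :: "nat \<Rightarrow> (nat list \<Rightarrow> int) \<Rightarrow> int" where
  "comp_sum 0 F = F []"
| "comp_sum (Suc a) F = - (\<Sum>b\<le>a. comp_sum (a - b) (\<lambda>\<beta>. F (Suc b # \<beta>)))"
  by pat_completeness auto
termination by (relation "measure fst") auto

text \<open>Linearity moves the choice of an ideal in a chain out of the alternating sum over
  compositions.\<close>

lemma comp_sum_sum:
  "comp_sum a (\<lambda>\<beta>. \<Sum>i\<in>A. F i \<beta>) = (\<Sum>i\<in>A. comp_sum a (F i))"
proof (induction a arbitrary: F rule: less_induct)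
  case (less a)
  show ?case
  proof (cases a)
    case (Suc c)
    have "comp_sum (c - b) (\<lambda>\<beta>. \<Sum>i\<in>A. F i (Suc b # \<beta>))
        = (\<Sum>i\<in>A. comp_sum (c - b) (\<lambda>\<beta>. F i (Suc b # \<beta>)))" for b
      by (rule less.IH) (simp add: Suc)
    then have "comp_sum a (\<lambda>\<beta>. \<Sum>i\<in>A. F i \<beta>)
        = - (\<Sum>b\<le>c. \<Sum>i\<in>A. comp_sum (c - b) (\<lambda>\<beta>. F i (Suc b # \<beta>)))"
      by (simp add: Suc)
    also have "\<dots> = (\<Sum>i\<in>A. comp_sum a (F i))"
      by (subst sum.swap) (simp add: Suc sum_negf)
    finally show ?thesis .
  qed simp
qed

section \<open>Chains of order ideals\<close>

definition ext_ideals :: "nat \<Rightarrow> (nat \<times> nat) set \<Rightarrow> nat set \<Rightarrow> nat \<Rightarrow> nat set set" where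
  "ext_ideals n r J a = {I. order_ideal n r I \<and> J \<subseteq> I \<and> card (I - J) = a}"

text \<open>If \<open>J\<close> is an ideal, everything in \<open>I\<close> above an element of
  \<open>I - J\<close> again lies in \<open>I - J\<close>. So maximality in \<open>I\<close> of all
  new elements says exactly that \<open>I - J\<close> is an antichain.\<close>

definition antichain_exts :: "nat \<Rightarrow> (nat \<times> nat) set \<Rightarrow> nat set \<Rightarrow> nat \<Rightarrow> nat set set" where
  "antichain_exts n r J a = {I \<in> ext_ideals n r J a. I - J \<subseteq> maximal_elements r I}"

lemma order_ideal_subset: "order_ideal n r I \<Longrightarrow> I \<subseteq> {1..n}"
  by (simp add: order_ideal_def)

lemma finite_order_ideal: "order_ideal n r I \<Longrightarrow> finite I"
  by (meson finite_atLeastAtMost finite_subset order_ideal_subset)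

lemma finite_order_ideals: "finite {I. order_ideal n r I}"
  by (rule finite_subset[of _ "Pow {1..n}"]) (auto simp: order_ideal_def)

lemma finite_ext_ideals: "finite (ext_ideals n r J a)"
  by (rule finite_subset[OF _ finite_order_ideals[of n r]]) (auto simp: ext_ideals_def)

lemma ext_ideals_0: "order_ideal n r J \<Longrightarrow> ext_ideals n r J 0 = {J}"
  by (auto simp: ext_ideals_def finite_order_ideal)

lemma antichain_exts_0: "order_ideal n r J \<Longrightarrow> antichain_exts n r J 0 = {J}"
  by (auto simp: antichain_exts_def ext_ideals_0)

lemma naturally_labeled_le: "naturally_labeled_poset n r \<Longrightarrow> (x, y) \<in> r \<Longrightarrow> x \<le> y"
  by (simp add: naturally_labeled_poset_def)

lemma naturally_labeled_subset: "naturally_labeled_poset n r \<Longrightarrow> r \<subseteq> {1..n} \<times> {1..n}"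
  by (simp add: naturally_labeled_poset_def partial_order_on_def preorder_on_def)

section \<open>The Moebius function of the lattice of ideals\<close>

lemma sum_alternating_Pow:
  assumes "finite A" "A \<noteq> {}"
  shows "(\<Sum>X\<in>Pow A. (- 1) ^ card X) = (0 :: int)"
proof -
  have "(\<Sum>X\<in>Pow A. (- 1) ^ card X) = (0 :: int) ^ card A"
    \<comment> \<open>The sum is the expansion of the product of \<open>1 - 1\<close> over
      \<open>A\<close>.\<close>
    using prod_diff_conv_sum[OF assms(1), of "\<lambda>_. 1 :: int" "\<lambda>_. 1"] by simp
  also have "\<dots> = 0"
    using assms by (simp add: card_gt_0_iff)
  finally show ?thesis .
qed

text \<open>Deleting maximal elements never breaks down-closure, so these ideals \<open>L\<close>
  are parametrised by arbitrary sets of maximal elements of \<open>I\<close> outside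
  \<open>J\<close>.\<close>

lemma antichain_ext_iff:
  assumes "order_ideal n r I" "order_ideal n r J" "J \<subseteq> I"
  shows "(\<exists>A \<subseteq> maximal_elements r I - J. L = I - A)
    \<longleftrightarrow> order_ideal n r L \<and> J \<subseteq> L \<and> L \<subseteq> I \<and> I - L \<subseteq> maximal_elements r I"
proof
  assume "\<exists>A \<subseteq> maximal_elements r I - J. L = I - A"
  then show "order_ideal n r L \<and> J \<subseteq> L \<and> L \<subseteq> I \<and> I - L \<subseteq> maximal_elements r I"
    using assms unfolding order_ideal_def maximal_elements_def by blast
next
  assume L: "order_ideal n r L \<and> J \<subseteq> L \<and> L \<subseteq> I \<and> I - L \<subseteq> maximal_elements r I"
  then show "\<exists>A \<subseteq> maximal_elements r I - J. L = I - A"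
    by (intro exI[of _ "I - L"]) auto
qed

text \<open>The largest label in \<open>I - J\<close> works: anything in \<open>I\<close> above it
  is outside the down-closed \<open>J\<close> and has at least as large a label.\<close>

lemma maximal_elements_diff_nonempty:
  assumes r: "naturally_labeled_poset n r"
    and I: "order_ideal n r I" and J: "order_ideal n r J" and "J \<subset> I"
  shows "maximal_elements r I - J \<noteq> {}"
proof -
  have fin: "finite (I - J)" and ne: "I - J \<noteq> {}"
    using finite_order_ideal[OF I] \<open>J \<subset> I\<close> by auto
  let ?x = "Max (I - J)"
  have x: "?x \<in> I - J" using fin ne by (rule Max_in)
  have "y = ?x" if "y \<in> I" "(?x, y) \<in> r" for y
  proof -
    have "y \<notin> J" using that J x by (auto simp: order_ideal_def)
    then have "y \<le> ?x" using fin that by simp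
    with naturally_labeled_le[OF r that(2)] show ?thesis by simp
  qed
  with x show ?thesis by (auto simp: maximal_elements_def)
qed

text \<open>This is the recurrence characterising the Moebius function, checked for its claimed
  values. The \<open>L\<close> correspond to the subsets of a nonempty set, over which signs
  cancel.\<close>

lemma moebius_order_ideals:
  assumes r: "naturally_labeled_poset n r"
    and I: "order_ideal n r I" and J: "order_ideal n r J" and "J \<subset> I"
  shows "(\<Sum>L | order_ideal n r L \<and> J \<subseteq> L \<and> L \<subseteq> I \<and> I - L \<subseteq> maximal_elements r I.
           (- 1) ^ card (I - L)) = (0 :: int)"
proof -
  let ?M = "maximal_elements r I - J"
  have M: "?M \<subseteq> I" by (auto simp: maximal_elements_def)
  have eq: "{L. order_ideal n r L \<and> J \<subseteq> L \<and> L \<subseteq> I \<and> I - L \<subseteq> maximal_elements r I}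
      = (\<lambda>A. I - A) ` Pow ?M" (is "?S = _")
  proof (rule set_eqI)
    fix L
    have "L \<in> ?S \<longleftrightarrow> (\<exists>A \<subseteq> ?M. L = I - A)"
      unfolding mem_Collect_eq
      using antichain_ext_iff[OF I J psubset_imp_subset[OF \<open>J \<subset> I\<close>], of L] by (rule sym)
    then show "L \<in> ?S \<longleftrightarrow> L \<in> (\<lambda>A. I - A) ` Pow ?M" by (simp add: image_iff Bex_def)
  qed
  have inj: "inj_on (\<lambda>A. I - A) (Pow ?M)"
    using M by (auto simp: inj_on_def)
  have "(\<Sum>L\<in>(\<lambda>A. I - A) ` Pow ?M. (- 1) ^ card (I - L)) = (\<Sum>A\<in>Pow ?M. (- 1) ^ card A :: int)"
    unfolding sum.reindex[OF inj] using M
    by (intro sum.cong) (auto intro!: arg_cong[of _ _ "\<lambda>A. (- 1) ^ card A"])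
  also have "\<dots> = 0"
    using maximal_elements_diff_nonempty[OF assms] finite_subset[OF M] finite_order_ideal[OF I]
    by (intro sum_alternating_Pow) auto
  finally show ?thesis by (simp add: eq)
qed

text \<open>
  A form of Philip Hall's theorem: an alternating sum over chains of ideals from \<open>J\<close> to \<open>I\<close> is
  the Moebius function, which detects whether \<open>I - J\<close> is an antichain.
\<close>

lemma comp_sum_chains:
  fixes \<Phi> :: "nat set \<Rightarrow> nat list \<Rightarrow> int"
  assumes r: "naturally_labeled_poset n r"
    and \<Phi>: "\<And>J b \<beta>. order_ideal n r J \<Longrightarrow> \<Phi> J (b # \<beta>) = (\<Sum>I\<in>ext_ideals n r J b. \<Phi> I \<beta>)"
    and "order_ideal n r J"
  shows "comp_sum a (\<Phi> J) = (- 1) ^ a * (\<Sum>I\<in>antichain_exts n r J a. \<Phi> I [])"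
  using \<open>order_ideal n r J\<close>
proof (induction a arbitrary: J rule: less_induct)
  case (less a)
  note J = less.prems
  show ?case
  proof (cases a)
    case 0
    then show ?thesis using J by (simp add: antichain_exts_0)
  next
    case (Suc c)
    let ?E = "ext_ideals n r J a"
    \<comment> \<open>\<open>g L I\<close> is the claimed Moebius value of the interval from
      \<open>L\<close> to \<open>I\<close>; \<open>W\<close> collects the possible first proper
      steps of a chain starting at \<open>J\<close>.\<close>
    define g where "g L I = (if L \<subseteq> I \<and> I - L \<subseteq> maximal_elements r I
        then (- 1) ^ card (I - L) else (0 :: int))" for L I
    define W where "W = {L. order_ideal n r L \<and> J \<subset> L \<and> card (L - J) \<le> a}"
    have card_diff: "card (I - L) = card (I - J) - card (L - J)" "card (L - J) \<le> card (I - J)"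
      if "order_ideal n r I" "J \<subseteq> L" "L \<subseteq> I" for I L
    proof -
      have "I - L = (I - J) - (L - J)" using that by auto
      moreover have "finite (I - J)" "finite (L - J)" "L - J \<subseteq> I - J"
        using finite_order_ideal[OF that(1)] that finite_subset[of L I] by auto
      ultimately show "card (I - L) = card (I - J) - card (L - J)" "card (L - J) \<le> card (I - J)"
        by (simp_all add: card_Diff_subset card_mono)
    qed
    have finW: "finite W"
      using finite_order_ideals[of n r] by (simp add: W_def)
    have step: "comp_sum (a - card (L - J)) (\<Phi> L) = (\<Sum>I\<in>?E. g L I * \<Phi> I [])" if "L \<in> W" for L
    proof -
      have L: "order_ideal n r L" "J \<subset> L" "card (L - J) \<le> a" using that by (auto simp: W_def)
      then have "card (L - J) > 0" using finite_order_ideal[of n r L] by (auto simp: card_gt_0_iff)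
      then have "comp_sum (a - card (L - J)) (\<Phi> L)
          = (- 1) ^ (a - card (L - J)) * (\<Sum>I\<in>antichain_exts n r L (a - card (L - J)). \<Phi> I [])"
        using L Suc by (intro less.IH) auto
      also have "\<dots> = (\<Sum>I\<in>antichain_exts n r L (a - card (L - J)). g L I * \<Phi> I [])"
        by (auto simp: sum_distrib_left antichain_exts_def ext_ideals_def g_def intro!: sum.cong)
      \<comment> \<open>Padding with zero terms makes the index set independent of \<open>L\<close>,
        so that the sums over \<open>L\<close> and \<open>I\<close> can be exchanged.\<close>
      also have "\<dots> = (\<Sum>I\<in>?E. g L I * \<Phi> I [])"
      proof (rule sum.mono_neutral_left[OF finite_ext_ideals])
        show "antichain_exts n r L (a - card (L - J)) \<subseteq> ?E"
        proof
          fix I assume "I \<in> antichain_exts n r L (a - card (L - J))"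
          then have I: "order_ideal n r I" "L \<subseteq> I" "card (I - L) = a - card (L - J)"
            by (auto simp: antichain_exts_def ext_ideals_def)
          then have "card (I - J) = a" using card_diff[of I L] L by auto
          then show "I \<in> ?E" using I L by (auto simp: ext_ideals_def)
        qed
        show "\<forall>I\<in>?E - antichain_exts n r L (a - card (L - J)). g L I * \<Phi> I [] = 0"
        proof
          fix I assume I: "I \<in> ?E - antichain_exts n r L (a - card (L - J))"
          then have "order_ideal n r I" "card (I - J) = a" by (auto simp: ext_ideals_def)
          then have "card (I - L) = a - card (L - J)" if "L \<subseteq> I"
            using card_diff(1)[of I L] L that by auto
          then have "g L I = 0"
            using I by (auto simp: antichain_exts_def ext_ideals_def g_def)
          then show "g L I * \<Phi> I [] = 0" by simp
        qed
      qed
      finally show ?thesis .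
    qed
    have W_eq: "W = (\<Union>b\<le>c. ext_ideals n r J (Suc b))"
    proof -
      have "0 < card (L - J)" if "order_ideal n r L" "J \<subset> L" for L
        using that finite_order_ideal[of n r L] by (auto simp: card_gt_0_iff)
      then show ?thesis
        unfolding W_def ext_ideals_def Suc
        by (auto simp: psubset_eq) (metis Suc_pred' atMost_iff not_less_eq_eq psubset_eq)+
    qed
    have "comp_sum a (\<Phi> J)
        = - (\<Sum>b\<le>c. \<Sum>L\<in>ext_ideals n r J (Suc b). comp_sum (c - b) (\<Phi> L))"
      by (simp add: Suc \<Phi>[OF J] comp_sum_sum)
    also have "(\<Sum>b\<le>c. \<Sum>L\<in>ext_ideals n r J (Suc b). comp_sum (c - b) (\<Phi> L))
        = (\<Sum>b\<le>c. \<Sum>L\<in>ext_ideals n r J (Suc b). comp_sum (a - card (L - J)) (\<Phi> L))"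
      by (intro sum.cong) (auto simp: ext_ideals_def Suc)
    also have "\<dots> = (\<Sum>L\<in>W. comp_sum (a - card (L - J)) (\<Phi> L))"
      unfolding W_eq
      by (rule sum.UNION_disjoint[symmetric]) (auto simp: finite_ext_ideals, auto simp: ext_ideals_def)
    also have "\<dots> = (\<Sum>L\<in>W. \<Sum>I\<in>?E. g L I * \<Phi> I [])"
      by (intro sum.cong refl step)
    also have "\<dots> = (\<Sum>I\<in>?E. (\<Sum>L\<in>W. g L I) * \<Phi> I [])"
      by (subst sum.swap) (simp add: sum_distrib_right)
    also have "\<dots> = (\<Sum>I\<in>?E. - g J I * \<Phi> I [])"
    proof (intro sum.cong refl arg_cong2[of _ _ _ _ "(*)"])
      fix I assume "I \<in> ?E"
      then have I: "order_ideal n r I" "J \<subseteq> I" "card (I - J) = a" by (auto simp: ext_ideals_def)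
      then have "J \<subset> I" using Suc by auto
      let ?S = "{L. order_ideal n r L \<and> J \<subseteq> L \<and> L \<subseteq> I \<and> I - L \<subseteq> maximal_elements r I}"
      \<comment> \<open>Adding the bottom element \<open>J\<close> to \<open>W\<close> covers every
        nonzero term of the interval from \<open>J\<close> to \<open>I\<close>. The full sum
        vanishes, so the part over \<open>W\<close> is \<open>- g J I\<close>.\<close>
      have "(\<Sum>L\<in>insert J W. g L I) = (\<Sum>L\<in>?S. (- 1) ^ card (I - L))"
      proof (rule sum.mono_neutral_cong_right)
        show "?S \<subseteq> insert J W"
          using card_diff(2)[OF I(1)] I(3) by (auto simp: W_def)
        show "\<forall>L\<in>insert J W - ?S. g L I = 0"
          using J by (auto simp: W_def g_def)
      qed (use finW in \<open>auto simp: g_def\<close>)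
      also have "\<dots> = 0" by (rule moebius_order_ideals[OF r I(1) J \<open>J \<subset> I\<close>])
      finally show "(\<Sum>L\<in>W. g L I) = - g J I"
        using finW by (simp add: W_def)
    qed
    also have "\<dots> = - (\<Sum>I\<in>?E. g J I * \<Phi> I [])" by (simp add: sum_negf)
    also have "(\<Sum>I\<in>?E. g J I * \<Phi> I []) = (\<Sum>I\<in>antichain_exts n r J a. (- 1) ^ a * \<Phi> I [])"
      by (intro sum.mono_neutral_cong_right finite_ext_ideals)
        (auto simp: antichain_exts_def ext_ideals_def g_def)
    finally show ?thesis by (simp add: sum_distrib_left)
  qed
qed

section \<open>Coefficients of the generating function\<close>

text \<open>
  The number of chains of ideals from \<open>J\<close> to \<open>{1..n}\<close> whose steps have the sizes listed in
  \<open>\<beta>\<close>; an entry \<open>0\<close> repeats an ideal.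
\<close>

fun chains :: "nat \<Rightarrow> (nat \<times> nat) set \<Rightarrow> nat set \<Rightarrow> nat list \<Rightarrow> int" where
  "chains n r J [] = (if J = {1..n} then 1 else 0)"
| "chains n r J (b # \<beta>) = (\<Sum>I\<in>ext_ideals n r J b. chains n r I \<beta>)"

text \<open>What is left of a P-partition after the elements of \<open>J\<close>, those of value at
  most \<open>l\<close>, are removed. The list \<open>\<beta>\<close> gives the fibre sizes over
  \<open>Suc l\<close>, \<open>Suc (Suc l)\<close> and so on; carrying \<open>l\<close> along avoids
  renumbering values in the recursion. The default \<open>0\<close> forbids values past the end of
  the list.\<close>

definition partitions_from ::
    "nat \<Rightarrow> (nat \<times> nat) set \<Rightarrow> nat \<Rightarrow> nat set \<Rightarrow> nat list \<Rightarrow> (nat \<Rightarrow> nat) set" where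
  "partitions_from n r l J \<beta> = {\<sigma> \<in> ({1..n} - J) \<rightarrow>\<^sub>E {l<..}.
     (\<forall>x y. (x, y) \<in> r \<longrightarrow> x \<notin> J \<longrightarrow> y \<notin> J \<longrightarrow> \<sigma> x \<le> \<sigma> y) \<and>
     (\<forall>v>l. card {p \<in> {1..n} - J. \<sigma> p = v}
        = (if v - Suc l < length \<beta> then \<beta> ! (v - Suc l) else 0))}"

lemma partitions_from_Nil:
  "partitions_from n r l J [] = (if {1..n} \<subseteq> J then {\<lambda>_. undefined} else {})"
proof -
  have False if "\<sigma> \<in> partitions_from n r l J []" "p \<in> {1..n} - J" for \<sigma> p
  proof -
    have "\<sigma> p > l" "card {q \<in> {1..n} - J. \<sigma> q = \<sigma> p} = 0"
      using that by (auto simp: partitions_from_def PiE_iff)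
    then show False using that by auto
  qed
  then have "partitions_from n r l J [] = {}" if "\<not> {1..n} \<subseteq> J"
    using that by blast
  moreover have "partitions_from n r l J [] = {\<lambda>_. undefined}" if "{1..n} \<subseteq> J"
  proof -
    have "{1..n} - J = {}" using that by auto
    then show ?thesis by (auto simp: partitions_from_def)
  qed
  ultimately show ?thesis by simp
qed

lemma nth_Cons_diff_Suc: "l < v \<Longrightarrow>
    (if v - Suc l < length (b # \<beta>) then (b # \<beta>) ! (v - Suc l) else 0)
    = (if v = Suc l then b else if v - Suc (Suc l) < length \<beta> then \<beta> ! (v - Suc (Suc l)) else 0)"
  by (auto simp: nth_Cons' Suc_diff_Suc)

text \<open>Deleting the elements of minimal value \<open>Suc l\<close> removes one step of the chain of ideals.\<close>

lemma bij_betw_partitions_from: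
  assumes r: "naturally_labeled_poset n r" and J: "order_ideal n r J"
  shows "bij_betw (\<lambda>(I, \<sigma>) p. if p \<in> I - J then Suc l else \<sigma> p)
    (SIGMA I:ext_ideals n r J b. partitions_from n r (Suc l) I \<beta>) (partitions_from n r l J (b # \<beta>))"
    (is "bij_betw ?f ?A ?B")
proof (rule bij_betw_byWitness[where f' =
      "\<lambda>\<sigma>. (J \<union> {p \<in> {1..n} - J. \<sigma> p = Suc l}, restrict \<sigma> {p \<in> {1..n} - J. \<sigma> p \<noteq> Suc l})"])
  have J_sub: "J \<subseteq> {1..n}" using J by (rule order_ideal_subset)
  have r_sub: "x \<in> {1..n}" "y \<in> {1..n}" if "(x, y) \<in> r" for x y
    using naturally_labeled_subset[OF r] that by auto
  have pos: "Suc l < \<sigma> p"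
    if "\<sigma> \<in> partitions_from n r (Suc l) I \<beta>" "p \<in> {1..n} - I" for I \<sigma> p
    using that by (auto simp: partitions_from_def PiE_iff)
  have undef: "\<sigma> p = undefined"
    if "\<sigma> \<in> partitions_from n r l' I \<beta>'" "p \<notin> {1..n} - I" for l' I \<sigma> p \<beta>'
    using that PiE_arb[of \<sigma> "{1..n} - I" _ p] by (auto simp: partitions_from_def)
  show "?f ` ?A \<subseteq> ?B"
  proof (rule image_subsetI, clarify)
    fix I \<sigma>
    assume "I \<in> ext_ideals n r J b" and \<sigma>: "\<sigma> \<in> partitions_from n r (Suc l) I \<beta>"
    then have I: "order_ideal n r I" "J \<subseteq> I" "card (I - J) = b"
      by (auto simp: ext_ideals_def)
    have I_sub: "I \<subseteq> {1..n}" using I(1) by (rule order_ideal_subset)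
    let ?\<tau> = "\<lambda>p. if p \<in> I - J then Suc l else \<sigma> p"
    have "?\<tau> \<in> ({1..n} - J) \<rightarrow>\<^sub>E {l<..}"
    proof (rule PiE_I)
      fix p assume "p \<in> {1..n} - J"
      then show "?\<tau> p \<in> {l<..}" using pos[OF \<sigma>, of p] by auto
    next
      fix p assume "p \<notin> {1..n} - J"
      then show "?\<tau> p = undefined" using undef[OF \<sigma>, of p] I_sub I(2) by auto
    qed
    \<comment> \<open>No relation leads from outside the ideal \<open>I\<close> up into it, and
      values outside \<open>I\<close> exceed \<open>Suc l\<close>.\<close>
    moreover have "?\<tau> x \<le> ?\<tau> y" if "(x, y) \<in> r" "x \<notin> J" "y \<notin> J" for x y
    proof (cases "y \<in> I")
      case True
      then have "x \<in> I" using I(1) that(1) by (auto simp: order_ideal_def)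
      then show ?thesis using True that by simp
    next
      case False
      then have "\<sigma> x \<le> \<sigma> y" if "x \<notin> I"
        using \<sigma> that \<open>(x, y) \<in> r\<close> by (auto simp: partitions_from_def)
      then show ?thesis
        using False pos[OF \<sigma>, of y] r_sub[OF that(1)] that(2) by auto
    qed
    moreover have "card {p \<in> {1..n} - J. ?\<tau> p = v}
        = (if v - Suc l < length (b # \<beta>) then (b # \<beta>) ! (v - Suc l) else 0)" if "v > l" for v
    proof (cases "v = Suc l")
      case True
      have "\<sigma> p \<noteq> Suc l" if "p \<in> {1..n} - I" for p
        using pos[OF \<sigma> that] by simp
      then have "{p \<in> {1..n} - J. ?\<tau> p = v} = I - J"
        using I_sub True by auto
      then show ?thesis using I True by simp
    next
      case False
      then have "{p \<in> {1..n} - J. ?\<tau> p = v} = {p \<in> {1..n} - I. \<sigma> p = v}"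
        using I(2) by auto
      then show ?thesis
        unfolding nth_Cons_diff_Suc[OF that] using \<sigma> False that by (simp add: partitions_from_def)
    qed
    ultimately show "?\<tau> \<in> ?B" by (simp add: partitions_from_def)
  qed
  show "(\<lambda>\<sigma>. (J \<union> {p \<in> {1..n} - J. \<sigma> p = Suc l},
      restrict \<sigma> {p \<in> {1..n} - J. \<sigma> p \<noteq> Suc l})) ` ?B \<subseteq> ?A"
  proof (rule image_subsetI)
    fix \<sigma> assume \<sigma>: "\<sigma> \<in> ?B"
    define I where "I = J \<union> {p \<in> {1..n} - J. \<sigma> p = Suc l}"
    have mono: "\<sigma> x \<le> \<sigma> y" if "(x, y) \<in> r" "x \<notin> J" "y \<notin> J" for x y
      using \<sigma> that by (simp add: partitions_from_def)
    have gt: "l < \<sigma> p" if "p \<in> {1..n} - J" for p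
      using \<sigma> that by (auto simp: partitions_from_def PiE_iff)
    have content: "card {p \<in> {1..n} - J. \<sigma> p = v}
        = (if v = Suc l then b else if v - Suc (Suc l) < length \<beta> then \<beta> ! (v - Suc (Suc l)) else 0)"
      if "v > l" for v
      using \<sigma> that nth_Cons_diff_Suc[OF that, of b \<beta>] by (simp add: partitions_from_def)
    \<comment> \<open>Since \<open>Suc l\<close> is the least possible value, an element outside
      \<open>J\<close> below one of value \<open>Suc l\<close> has that value too.\<close>
    have "y \<in> I" if "x \<in> I" "(y, x) \<in> r" for x y
    proof (cases "y \<in> J")
      case False
      then have "x \<notin> J" using J that by (auto simp: order_ideal_def)
      then have "\<sigma> y \<le> Suc l" using mono[OF that(2) False] that(1) by (auto simp: I_def)
      then show ?thesis using gt[of y] r_sub(1)[OF that(2)] False by (auto simp: I_def)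
    qed (simp add: I_def)
    moreover have "I - J = {p \<in> {1..n} - J. \<sigma> p = Suc l}" by (auto simp: I_def)
    ultimately have "I \<in> ext_ideals n r J b"
      using J_sub content[of "Suc l"] by (auto simp: ext_ideals_def order_ideal_def I_def)
    moreover have dom: "{p \<in> {1..n} - J. \<sigma> p \<noteq> Suc l} = {1..n} - I" by (auto simp: I_def)
    moreover have "restrict \<sigma> ({1..n} - I) \<in> partitions_from n r (Suc l) I \<beta>"
      unfolding partitions_from_def
    proof (intro CollectI conjI allI impI)
      have "Suc l < \<sigma> p" if "p \<in> {1..n} - I" for p
        using gt[of p] that unfolding I_def by fastforce
      then show "restrict \<sigma> ({1..n} - I) \<in> ({1..n} - I) \<rightarrow>\<^sub>E {Suc l<..}" by auto
      show "restrict \<sigma> ({1..n} - I) x \<le> restrict \<sigma> ({1..n} - I) y"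
        if "(x, y) \<in> r" "x \<notin> I" "y \<notin> I" for x y
        using that r_sub[OF that(1)] mono[OF that(1)] by (auto simp: I_def)
      fix v assume "v > Suc l"
      then have "{p \<in> {1..n} - I. restrict \<sigma> ({1..n} - I) p = v} = {p \<in> {1..n} - J. \<sigma> p = v}"
        by (auto simp: I_def)
      then show "card {p \<in> {1..n} - I. restrict \<sigma> ({1..n} - I) p = v}
          = (if v - Suc (Suc l) < length \<beta> then \<beta> ! (v - Suc (Suc l)) else 0)"
        using content[of v] \<open>v > Suc l\<close> by simp
    qed
    ultimately show "(J \<union> {p \<in> {1..n} - J. \<sigma> p = Suc l},
        restrict \<sigma> {p \<in> {1..n} - J. \<sigma> p \<noteq> Suc l}) \<in> ?A"
      unfolding dom by (simp add: I_def)
  qed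
  show "\<forall>x\<in>?A. (\<lambda>\<sigma>. (J \<union> {p \<in> {1..n} - J. \<sigma> p = Suc l},
      restrict \<sigma> {p \<in> {1..n} - J. \<sigma> p \<noteq> Suc l})) (?f x) = x"
  proof (clarify, intro conjI)
    fix I \<sigma>
    assume "I \<in> ext_ideals n r J b" and \<sigma>: "\<sigma> \<in> partitions_from n r (Suc l) I \<beta>"
    then have "J \<subseteq> I" "I \<subseteq> {1..n}"
      by (auto simp: ext_ideals_def order_ideal_def)
    let ?\<tau> = "\<lambda>p. if p \<in> I - J then Suc l else \<sigma> p"
    have ne: "\<sigma> p \<noteq> Suc l" if "p \<in> {1..n} - I" for p
      using pos[OF \<sigma> that] by simp
    show "J \<union> {p \<in> {1..n} - J. ?\<tau> p = Suc l} = I"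
      using \<open>J \<subseteq> I\<close> \<open>I \<subseteq> {1..n}\<close> ne by auto
    have "{p \<in> {1..n} - J. ?\<tau> p \<noteq> Suc l} = {1..n} - I"
      using \<open>J \<subseteq> I\<close> \<open>I \<subseteq> {1..n}\<close> ne by auto
    then show "restrict ?\<tau> {p \<in> {1..n} - J. ?\<tau> p \<noteq> Suc l} = \<sigma>"
      using undef[OF \<sigma>] by (auto simp: restrict_def)
  qed
  show "\<forall>\<sigma>\<in>?B. ?f ((\<lambda>\<sigma>. (J \<union> {p \<in> {1..n} - J. \<sigma> p = Suc l},
      restrict \<sigma> {p \<in> {1..n} - J. \<sigma> p \<noteq> Suc l})) \<sigma>) = \<sigma>"
  proof (intro ballI ext)
    fix \<sigma> p assume "\<sigma> \<in> ?B"
    then show "?f ((\<lambda>\<sigma>. (J \<union> {p \<in> {1..n} - J. \<sigma> p = Suc l},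
      restrict \<sigma> {p \<in> {1..n} - J. \<sigma> p \<noteq> Suc l})) \<sigma>) p = \<sigma> p"
      using undef[of \<sigma> l J "b # \<beta>" p] by auto
  qed
qed

lemma finite_partitions_from: "finite (partitions_from n r l J \<beta>)"
proof (rule finite_subset)
  show "partitions_from n r l J \<beta> \<subseteq> ({1..n} - J) \<rightarrow>\<^sub>E {..l + length \<beta>}"
  proof
    fix \<sigma> assume \<sigma>: "\<sigma> \<in> partitions_from n r l J \<beta>"
    have "\<sigma> p \<le> l + length \<beta>" if p: "p \<in> {1..n} - J" for p
    proof (rule ccontr)
      assume "\<not> \<sigma> p \<le> l + length \<beta>"
      \<comment> \<open>Beyond the list the prescribed fibre size is \<open>0\<close>, yet
        \<open>p\<close> lies in this fibre.\<close>
      then have "card {q \<in> {1..n} - J. \<sigma> q = \<sigma> p} = 0"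
        using \<sigma> by (auto simp: partitions_from_def)
      then show False using p by auto
    qed
    then show "\<sigma> \<in> ({1..n} - J) \<rightarrow>\<^sub>E {..l + length \<beta>}"
      using \<sigma> by (auto simp: partitions_from_def PiE_iff)
  qed
qed (auto intro: finite_PiE)

lemma chains_eq_card_partitions_from:
  assumes r: "naturally_labeled_poset n r" and "order_ideal n r J"
  shows "chains n r J \<beta> = int (card (partitions_from n r l J \<beta>))"
  using assms(2)
proof (induction \<beta> arbitrary: J l)
  case Nil
  then show ?case using order_ideal_subset[OF Nil] by (auto simp: partitions_from_Nil)
next
  case (Cons b \<beta>)
  have "card (partitions_from n r l J (b # \<beta>))
      = card (SIGMA I:ext_ideals n r J b. partitions_from n r (Suc l) I \<beta>)"
    using bij_betw_same_card[OF bij_betw_partitions_from[OF r Cons.prems]] by metis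
  also have "\<dots> = (\<Sum>I\<in>ext_ideals n r J b. card (partitions_from n r (Suc l) I \<beta>))"
    by (intro card_SigmaI) (auto simp: finite_ext_ideals finite_partitions_from)
  finally show ?case
    using Cons.IH[of _ "Suc l"] by (auto simp: ext_ideals_def intro!: sum.cong)
qed

section \<open>Reading chain counts off as coefficients of \<open>K\<close>\<close>

definition monomial_of_list :: "nat list \<Rightarrow> monomial" where
  "monomial_of_list \<beta> = (\<Sum>i<length \<beta>. Poly_Mapping.single (Suc i) (\<beta> ! i))"

lemma lookup_monomial_of_list:
  "Poly_Mapping.lookup (monomial_of_list \<beta>) v
    = (if 0 < v \<and> v - 1 < length \<beta> then \<beta> ! (v - 1) else 0)"
  by (cases v) (simp_all add: monomial_of_list_def lookup_sum lookup_single when_def)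

text \<open>A P-partition is the case \<open>l = 0\<close>, \<open>J = {}\<close> of
  \<open>partitions_from\<close>, values starting at 1. Only this link to \<open>K\<close> enters
  the comparison of two posets.\<close>

lemma chains_eq_K:
  assumes r: "naturally_labeled_poset n r"
  shows "chains n r {} \<beta> = K n r (monomial_of_list \<beta>)"
proof -
  have "{\<sigma> \<in> P_partitions n r. P_monomial n \<sigma> = monomial_of_list \<beta>} = partitions_from n r 0 {} \<beta>"
  proof (intro set_eqI iffI)
    fix \<sigma> assume "\<sigma> \<in> {\<sigma> \<in> P_partitions n r. P_monomial n \<sigma> = monomial_of_list \<beta>}"
    then have \<sigma>: "\<sigma> \<in> P_partitions n r"
      and eq: "Poly_Mapping.lookup (P_monomial n \<sigma>) = Poly_Mapping.lookup (monomial_of_list \<beta>)"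
      by auto
    show "\<sigma> \<in> partitions_from n r 0 {} \<beta>"
      using \<sigma> fun_cong[OF eq]
      by (auto simp: P_partitions_def partitions_from_def PiE_iff lookup_P_monomial
          lookup_monomial_of_list Suc_le_eq)
  next
    fix \<sigma> assume \<sigma>: "\<sigma> \<in> partitions_from n r 0 {} \<beta>"
    then have \<sigma>': "\<sigma> \<in> P_partitions n r"
      by (auto simp: P_partitions_def partitions_from_def PiE_iff Suc_le_eq)
    have "Poly_Mapping.lookup (P_monomial n \<sigma>) v
        = Poly_Mapping.lookup (monomial_of_list \<beta>) v" for v
    proof (cases "v = 0")
      \<comment> \<open>Membership in \<open>partitions_from\<close> prescribes fibres only above
        \<open>l = 0\<close>; the fibre over 0 is empty because values are positive.\<close>
      case True
      have "{p \<in> {1..n}. \<sigma> p = 0} = {}"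
        using \<sigma> by (auto simp: partitions_from_def PiE_iff)
      then show ?thesis using True by (simp only: lookup_P_monomial lookup_monomial_of_list) simp
    next
      case False
      then show ?thesis using \<sigma>
        by (simp add: lookup_P_monomial lookup_monomial_of_list partitions_from_def)
    qed
    then show "\<sigma> \<in> {\<sigma> \<in> P_partitions n r. P_monomial n \<sigma> = monomial_of_list \<beta>}"
      using \<sigma>' by (auto intro: poly_mapping_eqI)
  qed
  moreover have "order_ideal n r {}" by (simp add: order_ideal_def)
  ultimately show ?thesis
    using chains_eq_card_partitions_from[OF r, of "{}" \<beta> 0] by (simp add: K_def)
qed

section \<open>Extracting the numbers of maximal and minimal elements\<close>

lemma order_ideal_atLeastAtMost: "naturally_labeled_poset n r \<Longrightarrow> order_ideal n r {1..n}"
  using naturally_labeled_subset by (fastforce simp: order_ideal_def)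

lemma order_ideal_empty: "order_ideal n r {}"
  by (simp add: order_ideal_def)

text \<open>A last step must reach the top ideal, so only its size matters. This makes the end of
  each counted chain contribute 1, and with \<open>I = {}\<close> it recovers \<open>n\<close> from
  \<open>K\<close>.\<close>

lemma chains_singleton:
  assumes r: "naturally_labeled_poset n r" and I: "order_ideal n r I"
  shows "chains n r I [m] = (if card I + m = n then 1 else 0)"
proof -
  have sub: "I \<subseteq> {1..n}" using I by (rule order_ideal_subset)
  then have card: "card ({1..n} - I) = n - card I" "card I \<le> n"
    using card_mono[OF _ sub] by (simp_all add: card_Diff_subset finite_subset)
  have "chains n r I [m] = (if {1..n} \<in> ext_ideals n r I m then 1 else 0)"
    by (simp add: finite_ext_ideals sum.delta')
  also have "\<dots> = (if card I + m = n then 1 else 0)"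
    using card sub order_ideal_atLeastAtMost[OF r] by (auto simp: ext_ideals_def)
  finally show ?thesis .
qed

lemma card_ext_ideal: "I \<in> ext_ideals n r J a \<Longrightarrow> card I = card J + a"
proof -
  assume "I \<in> ext_ideals n r J a"
  then have "order_ideal n r I" "J \<subseteq> I" "card (I - J) = a" by (auto simp: ext_ideals_def)
  then show ?thesis
    using finite_order_ideal[of n r I] finite_subset[of J I] card_mono[of I J]
    by (auto simp: card_Diff_subset)
qed

text \<open>Such a \<open>J\<close> arises by deleting \<open>a\<close> chosen maximal elements of
  \<open>I\<close>.\<close>

lemma card_antichain_exts_below:
  assumes I: "order_ideal n r I"
  shows "card {J. order_ideal n r J \<and> I \<in> antichain_exts n r J a}
    = card (maximal_elements r I) choose a"
proof -
  let ?M = "maximal_elements r I"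
  have M: "?M \<subseteq> I" by (auto simp: maximal_elements_def)
  have "{J. order_ideal n r J \<and> I \<in> antichain_exts n r J a} = (\<lambda>A. I - A) ` {A. A \<subseteq> ?M \<and> card A = a}"
  proof (intro set_eqI iffI)
    fix J assume "J \<in> {J. order_ideal n r J \<and> I \<in> antichain_exts n r J a}"
    then show "J \<in> (\<lambda>A. I - A) ` {A. A \<subseteq> ?M \<and> card A = a}"
      by (intro image_eqI[of _ _ "I - J"]) (auto simp: antichain_exts_def ext_ideals_def)
  next
    fix J assume "J \<in> (\<lambda>A. I - A) ` {A. A \<subseteq> ?M \<and> card A = a}"
    then obtain A where A: "J = I - A" "A \<subseteq> ?M" "card A = a" by auto
    then have "I - J = A" using M by auto
    moreover have "order_ideal n r J"
      using antichain_ext_iff[OF I order_ideal_empty, of J] A by auto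
    ultimately show "J \<in> {J. order_ideal n r J \<and> I \<in> antichain_exts n r J a}"
      using A I by (auto simp: antichain_exts_def ext_ideals_def)
  qed
  moreover have "inj_on (\<lambda>A. I - A) {A. A \<subseteq> ?M \<and> card A = a}"
    using M by (auto simp: inj_on_def)
  ultimately show ?thesis
    using n_subsets[of ?M a] finite_subset[OF M] finite_order_ideal[OF I] by (simp add: card_image)
qed

text \<open>Such an extension arises by adding \<open>b\<close> chosen minimal elements of the
  complement of \<open>I\<close>.\<close>

lemma card_antichain_exts_above:
  assumes r: "naturally_labeled_poset n r" and I: "order_ideal n r I"
  shows "card (antichain_exts n r I b) = card (minimal_elements r ({1..n} - I)) choose b"
proof -
  let ?M = "minimal_elements r ({1..n} - I)"
  have M: "?M \<subseteq> {1..n} - I" by (auto simp: minimal_elements_def)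
  have I_sub: "I \<subseteq> {1..n}" using I by (rule order_ideal_subset)
  have "antichain_exts n r I b = (\<lambda>A. I \<union> A) ` {A. A \<subseteq> ?M \<and> card A = b}"
  proof (intro set_eqI iffI)
    fix L assume "L \<in> antichain_exts n r I b"
    then have L: "order_ideal n r L" "I \<subseteq> L" "card (L - I) = b" "L - I \<subseteq> maximal_elements r L"
      by (auto simp: antichain_exts_def ext_ideals_def)
    \<comment> \<open>An element outside \<open>I\<close> below some \<open>x\<close> in
      \<open>L - I\<close> lies in \<open>L - I\<close>, hence is maximal in \<open>L\<close>, hence
      equals \<open>x\<close>.\<close>
    have "L - I \<subseteq> ?M"
      using L I by (fastforce simp: minimal_elements_def maximal_elements_def order_ideal_def)
    then show "L \<in> (\<lambda>A. I \<union> A) ` {A. A \<subseteq> ?M \<and> card A = b}"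
      using L by (intro image_eqI[of _ _ "L - I"]) auto
  next
    fix L assume "L \<in> (\<lambda>A. I \<union> A) ` {A. A \<subseteq> ?M \<and> card A = b}"
    then obtain A where A: "L = I \<union> A" "A \<subseteq> ?M" "card A = b" by auto
    have I_down: "y \<in> I" if "x \<in> I" "(y, x) \<in> r" for x y
      using I that by (auto simp: order_ideal_def)
    have A_min: "y = x" if "x \<in> A" "y \<in> {1..n} - I" "(y, x) \<in> r" for x y
      using A(2) that by (auto simp: minimal_elements_def)
    have "y \<in> L" if "x \<in> L" "(y, x) \<in> r" for x y
    proof -
      have "y \<in> {1..n}" using naturally_labeled_subset[OF r] that(2) by blast
      then show ?thesis using that I_down[of x y] A_min[of x y] A(1) by auto
    qed
    then have "order_ideal n r L"
      using A(1,2) M I_sub by (auto simp: order_ideal_def)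
    moreover have "A \<subseteq> maximal_elements r L"
    proof
      fix x assume x: "x \<in> A"
      then have x': "x \<in> {1..n} - I" using A(2) M by auto
      \<comment> \<open>Here \<open>y\<close> cannot lie in \<open>I\<close>, which would then
        contain \<open>x\<close>. So \<open>y\<close> is in \<open>A\<close>, and its minimality in
        the complement gives \<open>y = x\<close>.\<close>
      have "y = x" if "y \<in> L" "(x, y) \<in> r" for y
        using that x' I_down[of y x] A_min[of y x] A(1) by auto
      then show "x \<in> maximal_elements r L" using x A(1) by (auto simp: maximal_elements_def)
    qed
    moreover have "L - I = A" using A M by auto
    ultimately show "L \<in> antichain_exts n r I b"
      using A by (auto simp: antichain_exts_def ext_ideals_def)
  qed
  moreover have "inj_on (\<lambda>A. I \<union> A) {A. A \<subseteq> ?M \<and> card A = b}"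
  proof (rule inj_onI, clarify)
    fix A B assume "A \<subseteq> ?M" "B \<subseteq> ?M" "I \<union> A = I \<union> B"
    then show "A = B" using M by blast
  qed
  ultimately show ?thesis
    using n_subsets[of ?M b] finite_subset[OF M] by (simp add: card_image)
qed

section \<open>Binomial moments of the two statistics, expressed by chain counts\<close>

definition choose_sum :: "nat \<Rightarrow> (nat \<times> nat) set \<Rightarrow> nat \<Rightarrow> nat \<Rightarrow> nat \<Rightarrow> int" where
  "choose_sum n r k a b = (\<Sum>I | order_ideal n r I \<and> card I = k.
     int (card (maximal_elements r I) choose a)
       * int (card (minimal_elements r ({1..n} - I)) choose b))"

text \<open>The chains pass through ideals \<open>J\<close>, \<open>I\<close>, \<open>L\<close> of
  sizes \<open>k - a\<close>, \<open>k\<close>, \<open>k + b\<close>. Refining the two middle steps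
  with signs keeps only the triples in which both differences are antichains. The bounds on
  \<open>a\<close> and \<open>b\<close> make the subtractions exact.\<close>

lemma choose_sum_eq_comp_sum:
  assumes r: "naturally_labeled_poset n r" and "a \<le> k" "k + b \<le> n"
  shows "choose_sum n r k a b = (- 1) ^ (a + b) *
    comp_sum a (\<lambda>\<beta>. comp_sum b (\<lambda>\<gamma>. chains n r {} ((k - a) # \<beta> @ \<gamma> @ [n - (k + b)])))"
proof -
  \<comment> \<open>By linearity \<open>\<Psi>\<close> satisfies the same recurrence as
    \<open>chains\<close>, so \<open>comp_sum_chains\<close> applies twice: to \<open>chains\<close>
    for the step above \<open>I\<close>, then to \<open>\<Psi>\<close> for the step below.\<close>
  define \<Psi> where "\<Psi> J \<beta> = comp_sum b (\<lambda>\<gamma>. chains n r J (\<beta> @ \<gamma> @ [n - (k + b)]))" for J \<beta>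
  have \<Psi>_Cons: "\<Psi> J (c # \<beta>) = (\<Sum>I\<in>ext_ideals n r J c. \<Psi> I \<beta>)" for J c \<beta>
    by (simp add: \<Psi>_def comp_sum_sum)
  have \<Psi>_Nil: "\<Psi> I [] = (- 1) ^ b * int (card (antichain_exts n r I b))"
    if I: "order_ideal n r I" "card I = k" for I
  proof -
    have "\<Psi> I [] = comp_sum b (\<lambda>\<gamma>. chains n r I (\<gamma> @ [n - (k + b)]))"
      by (simp only: \<Psi>_def append_Nil)
    also have "\<dots> = (- 1) ^ b * (\<Sum>L\<in>antichain_exts n r I b. chains n r L ([] @ [n - (k + b)]))"
      by (rule comp_sum_chains[where \<Phi> = "\<lambda>L \<gamma>. chains n r L (\<gamma> @ [n - (k + b)])", OF r _ I(1)]) simp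
    also have "(\<Sum>L\<in>antichain_exts n r I b. chains n r L ([] @ [n - (k + b)]))
        = (\<Sum>L\<in>antichain_exts n r I b. 1)"
    proof (intro sum.cong refl)
      fix L assume "L \<in> antichain_exts n r I b"
      then have "L \<in> ext_ideals n r I b" "order_ideal n r L"
        by (auto simp: antichain_exts_def ext_ideals_def)
      then show "chains n r L ([] @ [n - (k + b)]) = 1"
        using card_ext_ideal[of L n r I b] I(2) assms(3)
        by (simp add: chains_singleton[OF r] del: chains.simps)
    qed
    finally show ?thesis by simp
  qed
  let ?S = "ext_ideals n r {} (k - a)"
  let ?T = "{I. order_ideal n r I \<and> card I = k}"
  have T: "finite ?T" using finite_order_ideals[of n r] by simp
  have "comp_sum a (\<lambda>\<beta>. \<Psi> {} ((k - a) # \<beta>)) = (\<Sum>J\<in>?S. comp_sum a (\<Psi> J))"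
    by (simp add: \<Psi>_Cons comp_sum_sum)
  also have "\<dots> = (\<Sum>J\<in>?S. (- 1) ^ a * (\<Sum>I\<in>antichain_exts n r J a. \<Psi> I []))"
    by (intro sum.cong refl comp_sum_chains[OF r]) (auto simp: \<Psi>_Cons ext_ideals_def)
  also have "\<dots> = (- 1) ^ a * (\<Sum>J\<in>?S. \<Sum>I | I \<in> ?T \<and> I \<in> antichain_exts n r J a. \<Psi> I [])"
    unfolding sum_distrib_left[symmetric]
  proof (intro arg_cong2[of _ _ _ _ "(*)"] sum.cong refl)
    fix J assume "J \<in> ?S"
    then have "card J = k - a" by (simp add: ext_ideals_def)
    then have "I \<in> ?T" if "I \<in> antichain_exts n r J a" for I
      using that card_ext_ideal[of I n r J a] assms(2)
      by (simp add: antichain_exts_def ext_ideals_def)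
    then show "antichain_exts n r J a = {I. I \<in> ?T \<and> I \<in> antichain_exts n r J a}"
      by blast
  qed
  \<comment> \<open>Regroup the pairs by the upper ideal \<open>I\<close>, so that both binomial
    counts can be taken at a fixed \<open>I\<close>.\<close>
  also have "(\<Sum>J\<in>?S. \<Sum>I | I \<in> ?T \<and> I \<in> antichain_exts n r J a. \<Psi> I [])
      = (\<Sum>I\<in>?T. \<Sum>J | J \<in> ?S \<and> I \<in> antichain_exts n r J a. \<Psi> I [])"
    by (rule sum.swap_restrict[OF finite_ext_ideals T])
  also have "\<dots> = (\<Sum>I\<in>?T. (- 1) ^ b * (int (card (maximal_elements r I) choose a)
      * int (card (minimal_elements r ({1..n} - I)) choose b)))"
  proof (intro sum.cong refl)
    fix I assume "I \<in> ?T"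
    then have I: "order_ideal n r I" "card I = k" by auto
    have "J \<in> ?S \<longleftrightarrow> order_ideal n r J" if "I \<in> antichain_exts n r J a" for J
      using that card_ext_ideal[of I n r J a] I(2) by (auto simp: antichain_exts_def ext_ideals_def)
    then have "{J. J \<in> ?S \<and> I \<in> antichain_exts n r J a}
        = {J. order_ideal n r J \<and> I \<in> antichain_exts n r J a}"
      by blast
    then show "(\<Sum>J | J \<in> ?S \<and> I \<in> antichain_exts n r J a. \<Psi> I [])
        = (- 1) ^ b * (int (card (maximal_elements r I) choose a)
          * int (card (minimal_elements r ({1..n} - I)) choose b))"
      using I by (simp add: \<Psi>_Nil card_antichain_exts_below card_antichain_exts_above[OF r])
  qed
  also have "\<dots> = (- 1) ^ b * choose_sum n r k a b"
    by (simp add: choose_sum_def sum_distrib_left)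
  finally have "choose_sum n r k a b = (- 1) ^ (a + b) * comp_sum a (\<lambda>\<beta>. \<Psi> {} ((k - a) # \<beta>))"
    by (simp add: minus_one_power_iff)
  then show ?thesis by (simp only: \<Psi>_def append_Cons)
qed

section \<open>Binomial inversion\<close>

lemma card_maximal_elements_le:
  assumes "order_ideal n r I"
  shows "card (maximal_elements r I) \<le> card I"
  using finite_order_ideal[OF assms] by (intro card_mono) (auto simp: maximal_elements_def)

lemma card_minimal_elements_le:
  assumes "order_ideal n r I"
  shows "card (minimal_elements r ({1..n} - I)) \<le> n - card I"
proof -
  have "card (minimal_elements r ({1..n} - I)) \<le> card ({1..n} - I)"
    by (intro card_mono) (auto simp: minimal_elements_def)
  then show ?thesis
    using order_ideal_subset[OF assms] finite_order_ideal[OF assms] by (simp add: card_Diff_subset)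
qed

text \<open>Out of range, one of the two binomials vanishes for every ideal of size
  \<open>k\<close>. This covers the cases where truncated subtraction rules out the chain
  formula.\<close>

lemma choose_sum_eq_0:
  assumes "\<not> (a \<le> k \<and> k + b \<le> n)"
  shows "choose_sum n r k a b = 0"
  unfolding choose_sum_def
proof (intro sum.neutral ballI)
  fix I assume "I \<in> {I. order_ideal n r I \<and> card I = k}"
  then have I: "order_ideal n r I" "card I = k" by auto
  have "k \<le> n" using card_mono[OF _ order_ideal_subset[OF I(1)]] I(2) by simp
  then have "card (maximal_elements r I) < a \<or> card (minimal_elements r ({1..n} - I)) < b"
    using card_maximal_elements_le[OF I(1)] card_minimal_elements_le[OF I(1)] assms I(2) by auto
  then show "int (card (maximal_elements r I) choose a)
      * int (card (minimal_elements r ({1..n} - I)) choose b) = 0"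
    by auto
qed

text \<open>The orthogonality behind binomial inversion: choosing an \<open>i\<close>-set inside an
  \<open>a\<close>-set is choosing the \<open>i\<close>-set first, which leaves an alternating row
  sum of Pascal's triangle.\<close>

lemma sum_alternating_choose_mult:
  assumes "m \<le> n"
  shows "(\<Sum>a\<le>n. (- 1) ^ (a + i) * int (a choose i) * int (m choose a)) = (if m = i then 1 else 0)"
proof (cases "i \<le> m")
  case False
  then have "(\<Sum>a\<le>n. (- 1) ^ (a + i) * int (a choose i) * int (m choose a)) = 0"
    by (intro sum.neutral) auto
  then show ?thesis using False by simp
next
  case True
  have "(\<Sum>a\<le>n. (- 1) ^ (a + i) * int (a choose i) * int (m choose a))
      = (\<Sum>a\<in>{i..m}. (- 1) ^ (a + i) * int (a choose i) * int (m choose a))"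
    using assms by (intro sum.mono_neutral_right) auto
  also have "\<dots> = (\<Sum>c\<le>m - i. (- 1) ^ c * int (m choose i) * int ((m - i) choose c))"
  proof (rule sum.reindex_bij_witness[of _ "\<lambda>c. c + i" "\<lambda>a. a - i"])
    fix a assume a: "a \<in> {i..m}"
    have "(m choose a) * (a choose i) = (m choose i) * ((m - i) choose (a - i))"
      using a by (intro choose_mult) auto
    then have "int (a choose i) * int (m choose a) = int (m choose i) * int ((m - i) choose (a - i))"
      by (metis mult.commute of_nat_mult)
    moreover have "(- 1) ^ (a + i) = ((- 1) ^ (a - i) :: int)"
      using a by (simp add: minus_one_power_iff)
    ultimately show "(- 1) ^ (a - i) * int (m choose i) * int ((m - i) choose (a - i))
        = (- 1) ^ (a + i) * int (a choose i) * int (m choose a)"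
      by (simp add: mult.assoc)
  qed (use True in auto)
  also have "\<dots> = int (m choose i) * (\<Sum>c\<le>m - i. (- 1) ^ c * int ((m - i) choose c))"
    by (simp add: sum_distrib_left mult_ac)
  also have "\<dots> = (if m = i then 1 else 0)"
    using True choose_alternating_sum[of "m - i", where 'a = int] by auto
  finally show ?thesis .
qed

text \<open>Inversion in both variables. Summing up to \<open>n\<close> suffices because both
  statistics of an ideal are at most \<open>n\<close>; for each ideal the double sum factors into
  two indicators.\<close>

lemma anti_eq_choose_sum:
  "int (anti k i j n r) = (\<Sum>a\<le>n. \<Sum>b\<le>n. (- 1) ^ (a + i) * int (a choose i)
     * ((- 1) ^ (b + j) * int (b choose j)) * choose_sum n r k a b)"
proof -
  let ?T = "{I. order_ideal n r I \<and> card I = k}"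
  let ?x = "\<lambda>I. card (maximal_elements r I)"
  let ?y = "\<lambda>I. card (minimal_elements r ({1..n} - I))"
  have T: "finite ?T" using finite_order_ideals[of n r] by simp
  have "(\<Sum>a\<le>n. \<Sum>b\<le>n. (- 1) ^ (a + i) * int (a choose i)
      * ((- 1) ^ (b + j) * int (b choose j)) * choose_sum n r k a b)
      = (\<Sum>a\<le>n. \<Sum>b\<le>n. \<Sum>I\<in>?T. ((- 1) ^ (a + i) * int (a choose i) * int (?x I choose a))
        * ((- 1) ^ (b + j) * int (b choose j) * int (?y I choose b)))"
    by (simp add: choose_sum_def sum_distrib_left mult_ac)
  also have "\<dots> = (\<Sum>a\<le>n. \<Sum>I\<in>?T. \<Sum>b\<le>n. ((- 1) ^ (a + i) * int (a choose i) * int (?x I choose a))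
        * ((- 1) ^ (b + j) * int (b choose j) * int (?y I choose b)))"
    by (intro sum.cong refl sum.swap)
  also have "\<dots> = (\<Sum>I\<in>?T. \<Sum>a\<le>n. \<Sum>b\<le>n. ((- 1) ^ (a + i) * int (a choose i) * int (?x I choose a))
        * ((- 1) ^ (b + j) * int (b choose j) * int (?y I choose b)))"
    by (rule sum.swap)
  also have "\<dots> = (\<Sum>I\<in>?T. (\<Sum>a\<le>n. (- 1) ^ (a + i) * int (a choose i) * int (?x I choose a))
        * (\<Sum>b\<le>n. (- 1) ^ (b + j) * int (b choose j) * int (?y I choose b)))"
    by (simp only: sum_product)
  also have "\<dots> = (\<Sum>I\<in>?T. if ?x I = i \<and> ?y I = j then 1 else 0)"
  proof (intro sum.cong refl)
    fix I assume "I \<in> ?T"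
    then have I: "order_ideal n r I" by simp
    have "card I \<le> n" using card_mono[OF _ order_ideal_subset[OF I]] by simp
    then have "?x I \<le> n" "?y I \<le> n"
      using card_maximal_elements_le[OF I] card_minimal_elements_le[OF I] by auto
    then show "(\<Sum>a\<le>n. (- 1) ^ (a + i) * int (a choose i) * int (?x I choose a))
        * (\<Sum>b\<le>n. (- 1) ^ (b + j) * int (b choose j) * int (?y I choose b))
        = (if ?x I = i \<and> ?y I = j then 1 else 0)"
      by (simp only: sum_alternating_choose_mult) simp
  qed
  also have "\<dots> = int (anti k i j n r)"
    using T by (simp add: anti_def sum.If_cases Int_def conj_assoc)
  finally show ?thesis by simp
qed

theorem theorem3p4:
  fixes n m :: nat and P Q :: "(nat \<times> nat) set"
  assumes "naturally_labeled_poset n P"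
    and "naturally_labeled_poset m Q"
    and "K n P = K m Q"
  shows "\<forall>k i j. anti k i j n P = anti k i j m Q"
proof -
  have chains_eq: "chains n P {} \<beta> = chains m Q {} \<beta>" for \<beta>
    using assms by (simp add: chains_eq_K)
  \<comment> \<open>The coefficient at the list \<open>[n]\<close> is 1 for \<open>P\<close>, and
    for \<open>Q\<close> it is nonzero only if \<open>m = n\<close>.\<close>
  have "n = m"
    using chains_singleton[OF assms(1) order_ideal_empty, of n]
      chains_singleton[OF assms(2) order_ideal_empty, of n] chains_eq[of "[n]"]
    by (simp del: chains.simps split: if_splits)
  then have "choose_sum n P k a b = choose_sum m Q k a b" for k a b
    using assms(1,2) chains_eq
    by (cases "a \<le> k \<and> k + b \<le> n") (auto simp: choose_sum_eq_comp_sum choose_sum_eq_0 simp del: chains.simps)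
  then have "int (anti k i j n P) = int (anti k i j m Q)" for k i j
    using \<open>n = m\<close> by (simp add: anti_eq_choose_sum)
  then show ?thesis by simp
qed

end
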